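(* Let $\Omega_1,\dots,\Omega_p$ ($p\ge1$) and $S$ be nonempty closed convex subsets of $\mathbb{R}^n$ with $\Omega_i\cap S=\emptyset$ for every $i\in I:=\{1,\dots,p\}$, let $\alpha_i>0$ for $i\in I$, $\lambda>0$ and $v\in\mathbb{R}^n$. Consider the problem $$(P_v)\qquad\min\Big\{\varphi_v(x)=\sum_{i\in I}\alpha_i d(x;\Omega_i)+\frac{\lambda}{2}\|x\|^2-\langle v,x\rangle\;\Big|\;x\in S\Big\}.$$ The sequence $\{x_k\}$ produced by the generalized Weiszfeld algorithm, i.e., $x_0\in S$ arbitrary and $x_{k+1}=P(F_v(x_k);S)$ for $k=0,1,2,\dots$, with $F_v$ the mapping defined in the context, converges to the unique solution of problem $(P_v)$.
   Context: $\mathbb{R}^n$ carries the Euclidean inner product $\langle\cdot,\cdot\rangle$ and norm $\|\cdot\|$. For a nonempty closed convex set $Q\subset\mathbb{R}^n$, $d(x;Q)=\inf\{\|x-w\|\;|\;w\in Q\}$ and $P(x;Q)$ is the Euclidean projection of $x$ to $Q$, i.e., the unique $w\in Q$ with $\|x-w\|=d(x;Q)$. The mapping $F_v:S\to\mathbb{R}^n$ is $$F_v(x)=\frac{\sum_{i\in I}\frac{\alpha_i P(x;\Omega_i)}{d(x;\Omega_i)}+v}{\sum_{i\in I}\frac{\alpha_i}{d(x;\Omega_i)}+\lambda},\quad x\in S.$$ *)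

theory Defs
  imports "HOL-Analysis.Analysis"
begin

text \<open>
  For a nonempty closed convex set \<open>Q\<close>, the distance \<open>d(x;Q)\<close> is \<^term>\<open>infdist x Q\<close> and the
  Euclidean projection \<open>P(x;Q)\<close> is \<^term>\<open>closest_point Q x\<close>.
\<close>

definition weiszfeld_objective ::
    "nat \<Rightarrow> (nat \<Rightarrow> (real ^ 'n) set) \<Rightarrow> (nat \<Rightarrow> real) \<Rightarrow> real \<Rightarrow> real ^ 'n \<Rightarrow> real ^ 'n \<Rightarrow> real"
  where "weiszfeld_objective p \<Omega> \<alpha> l v x =
    (\<Sum>i\<in>{1..p}. \<alpha> i * infdist x (\<Omega> i)) + l / 2 * (norm x)\<^sup>2 - v \<bullet> x"

text \<open>
  The mapping \<open>F_v\<close> is only meaningful on \<open>S\<close>, where every closed set \<open>\<Omega> i\<close> is at positive distance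
  because it is disjoint from \<open>S\<close>. Elsewhere the value is junk (division by zero).
\<close>

definition weiszfeld_map ::
    "nat \<Rightarrow> (nat \<Rightarrow> (real ^ 'n) set) \<Rightarrow> (nat \<Rightarrow> real) \<Rightarrow> real \<Rightarrow> real ^ 'n \<Rightarrow> real ^ 'n \<Rightarrow> real ^ 'n"
  where "weiszfeld_map p \<Omega> \<alpha> l v x =
    ((\<Sum>i\<in>{1..p}. (\<alpha> i / infdist x (\<Omega> i)) *\<^sub>R closest_point (\<Omega> i) x) + v)
      /\<^sub>R ((\<Sum>i\<in>{1..p}. \<alpha> i / infdist x (\<Omega> i)) + l)"

end

theory Submission
  imports Defs
begin

text \<open>
  The function \<open>F_v\<close> is a gradient step in disguise. Put \<open>w_i(y) = \<alpha>_i / d(y;\<Omega>_i)\<close> and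
  \<open>W(y) = \<Sum>\<^sub>i w_i(y) + \<lambda>\<close>, where \<open>\<lambda>\<close> is the parameter written \<open>l\<close> in the formal text.
  Away from \<open>\<Omega>_i\<close> the distance function has the gradient
  \<open>(y - P(y;\<Omega>_i)) / d(y;\<Omega>_i)\<close>, so \<open>W(y) (y - F_v(y))\<close> is the gradient of \<open>\<phi>_v\<close> at a point \<open>y\<close> outside
  all the sets, and \<open>F_v(y)\<close> is the gradient step from \<open>y\<close> with step size \<open>1 / W(y)\<close>. The objective lies between two
  quadratics with this slope at \<open>y\<close>, for every \<open>x\<close>:
  \<open>\<phi>_v(y) + W(y) \<langle>y - F_v(y), x - y\<rangle> + \<lambda>/2 \<parallel>x - y\<parallel>\<^sup>2 \<le> \<phi>_v(x)\<close>, because the distances are convex, and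
  \<open>\<phi>_v(x) \<le> \<phi>_v(y) + W(y) \<langle>y - F_v(y), x - y\<rangle> + W(y)/2 \<parallel>x - y\<parallel>\<^sup>2\<close>, which is Weiszfeld's majorization of each
  distance by a quadratic (lemmas \<open>objective_lower\<close> and \<open>objective_upper\<close>).

  The upper quadratic is minimized over \<open>S\<close> exactly at the projection \<open>y'\<close> of \<open>F_v(y)\<close>. Hence
  \<open>\<phi>_v(y') \<le> \<phi>_v(y) - W(y)/2 \<parallel>y' - y\<parallel>\<^sup>2\<close> (compare \<open>descent\<close>): the values
  decrease and, being bounded below by the minimum, force \<open>\<parallel>x\<^sub>k\<^sub>+\<^sub>1 - x\<^sub>k\<parallel> \<rightarrow> 0\<close>. The lower quadratic bounds the sublevel sets, which gives a minimizer and keeps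
  the iterates in a compact part of \<open>S\<close>, where \<open>W\<close> is bounded since the distances stay away from zero.

  Short steps are possible only near a minimizer: if \<open>z\<close> is one and \<open>y\<close> lies in \<open>S\<close>, the lower quadratic at \<open>y\<close>
  and the variational inequality of the projection give the error bound
  \<open>\<lambda>/2 \<parallel>y - z\<parallel>\<^sup>2 \<le> (W(y) \<parallel>y - z\<parallel> + \<parallel>W(y) (y - F_v(y))\<parallel>) \<parallel>y' - y\<parallel>\<close>
  (lemma \<open>error_bound\<close>), whose first factor is bounded along the iterates and whose second factor tends to zero.
  Since this holds for every minimizer, uniqueness of limits yields uniqueness of the minimizer.
\<close>

section \<open>Quadratic bounds for the distance to a convex set\<close>

lemma infdist_eq_norm_closest_point:
  fixes Q :: "'a::euclidean_space set"
  assumes "closed Q" "Q \<noteq> {}"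
  shows "infdist y Q = norm (y - closest_point Q y)"
  using assms setdist_closest_point[of Q y] by (simp add: infdist_eq_setdist dist_norm)

text \<open>
  The unit vector \<open>(y - P(y;Q)) / d(y;Q)\<close> is a subgradient at \<open>y\<close>: the half-space through \<open>P(y;Q)\<close> with this
  outer normal contains \<open>Q\<close>, and in particular the projection of \<open>x\<close>.
\<close>

lemma infdist_lower_linear:
  fixes Q :: "'a::euclidean_space set"
  assumes "closed Q" "convex Q" "Q \<noteq> {}" "0 < infdist y Q"
  shows "infdist y Q + ((y - closest_point Q y) \<bullet> (x - y)) / infdist y Q \<le> infdist x Q"
proof -
  define u where "u = y - closest_point Q y"
  define q where "q = closest_point Q x"
  have nu: "norm u = infdist y Q"
    using assms infdist_eq_norm_closest_point[of Q y] by (simp add: u_def)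
  have "u \<bullet> (q - closest_point Q y) \<le> 0"
    unfolding u_def q_def using assms by (intro closest_point_dot closest_point_in_set)
  moreover have "u \<bullet> (x - q) = u \<bullet> (x - y) + u \<bullet> u - u \<bullet> (q - closest_point Q y)"
    by (simp add: u_def algebra_simps)
  moreover have "u \<bullet> (x - q) \<le> infdist y Q * infdist x Q"
    using norm_cauchy_schwarz[of u "x - q"] assms infdist_eq_norm_closest_point[of Q x]
    by (simp add: nu q_def)
  ultimately have "u \<bullet> (x - y) + (infdist y Q)\<^sup>2 \<le> infdist y Q * infdist x Q"
    by (simp add: nu[symmetric] power2_norm_eq_inner)
  with assms(4) show ?thesis
    unfolding u_def[symmetric] by (simp add: field_simps power2_eq_square)
qed

text \<open>
  Two estimates are combined: \<open>d(x;Q) \<le> \<parallel>x - P(y;Q)\<parallel>\<close>, and \<open>t \<le> t\<^sup>2 / (2 d) + d / 2\<close>, which is the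
  arithmetic-geometric mean inequality for \<open>t\<^sup>2 / d\<close> and \<open>d = d(y;Q)\<close>. Both are equalities at \<open>x = y\<close>.
\<close>

lemma infdist_upper_quadratic:
  fixes Q :: "'a::euclidean_space set"
  assumes "closed Q" "Q \<noteq> {}" "0 < infdist y Q"
  shows "infdist x Q \<le> infdist y Q + ((y - closest_point Q y) \<bullet> (x - y)) / infdist y Q
    + (norm (x - y))\<^sup>2 / (2 * infdist y Q)"
proof -
  define u where "u = y - closest_point Q y"
  define d where "d = infdist y Q"
  define t where "t = norm (x - closest_point Q y)"
  have d: "norm u = d" "0 < d"
    using assms infdist_eq_norm_closest_point[of Q y] by (simp_all add: u_def d_def)
  have le: "infdist x Q \<le> t"
    using infdist_le[OF closest_point_in_set[OF assms(1,2)], of x] by (simp add: t_def dist_norm)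
  have "t = norm (u + (x - y))" by (simp add: t_def u_def)
  hence "t\<^sup>2 = d\<^sup>2 + 2 * (u \<bullet> (x - y)) + (norm (x - y))\<^sup>2"
    by (simp add: d(1)[symmetric] power2_norm_eq_inner inner_add_left inner_add_right
      inner_commute[of "x - y" u] del: inner_diff_right inner_diff_left)
  moreover have "2 * d * t \<le> t\<^sup>2 + d\<^sup>2"
    using sum_squares_bound[of d t] by (simp add: add.commute)
  ultimately have "2 * d * t \<le> 2 * d\<^sup>2 + 2 * (u \<bullet> (x - y)) + (norm (x - y))\<^sup>2"
    by linarith
  hence "t \<le> (2 * d\<^sup>2 + 2 * (u \<bullet> (x - y)) + (norm (x - y))\<^sup>2) / (2 * d)"
    using d(2) by (simp add: pos_le_divide_eq mult.commute)
  also have "\<dots> = d + (u \<bullet> (x - y)) / d + (norm (x - y))\<^sup>2 / (2 * d)"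
    using d(2) by (simp add: add_divide_distrib power2_eq_square)
  finally have "t \<le> d + (u \<bullet> (x - y)) / d + (norm (x - y))\<^sup>2 / (2 * d)" .
  with le show ?thesis by (simp add: u_def d_def)
qed

section \<open>The objective and one step of the algorithm\<close>

locale weiszfeld =
  fixes p :: nat
    and \<Omega> :: "nat \<Rightarrow> (real ^ 'n) set"
    and S :: "(real ^ 'n) set"
    and \<alpha> :: "nat \<Rightarrow> real"
    and l :: real
    and v :: "real ^ 'n"
  assumes sets: "\<And>i. i \<in> {1..p} \<Longrightarrow> \<Omega> i \<noteq> {} \<and> closed (\<Omega> i) \<and> convex (\<Omega> i)"
    and S: "S \<noteq> {}" "closed S" "convex S"
    and disjoint: "\<And>i. i \<in> {1..p} \<Longrightarrow> \<Omega> i \<inter> S = {}"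
    and \<alpha>: "\<And>i. i \<in> {1..p} \<Longrightarrow> 0 < \<alpha> i"
    and l: "0 < l"
begin

abbreviation \<phi> where "\<phi> \<equiv> weiszfeld_objective p \<Omega> \<alpha> l v"
abbreviation F where "F \<equiv> weiszfeld_map p \<Omega> \<alpha> l v"

definition W :: "real ^ 'n \<Rightarrow> real"
  where "W y = (\<Sum>i\<in>{1..p}. \<alpha> i / infdist y (\<Omega> i)) + l"

definition T :: "real ^ 'n \<Rightarrow> real ^ 'n"
  where "T y = closest_point S (F y)"

lemma infdist_pos: "i \<in> {1..p} \<Longrightarrow> y \<in> S \<Longrightarrow> 0 < infdist y (\<Omega> i)"
  using sets[of i] disjoint[of i] infdist_pos_not_in_closed[of "\<Omega> i" y] by auto

lemma W_ge: "l \<le> W y"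
  unfolding W_def using \<alpha> by (auto intro!: sum_nonneg divide_nonneg_nonneg simp: infdist_nonneg less_imp_le)

lemma W_pos: "0 < W y"
  using W_ge[of y] l by linarith

lemma T_in_S: "T y \<in> S"
  unfolding T_def using S by (intro closest_point_in_set)

lemma W_gradient:
  "W y *\<^sub>R (y - F y)
    = (\<Sum>i\<in>{1..p}. (\<alpha> i / infdist y (\<Omega> i)) *\<^sub>R (y - closest_point (\<Omega> i) y)) + l *\<^sub>R y - v"
proof -
  have "W y *\<^sub>R F y = (\<Sum>i\<in>{1..p}. (\<alpha> i / infdist y (\<Omega> i)) *\<^sub>R closest_point (\<Omega> i) y) + v"
    using W_pos[of y] unfolding weiszfeld_map_def W_def[symmetric] by simp
  moreover have "W y *\<^sub>R y = (\<Sum>i\<in>{1..p}. (\<alpha> i / infdist y (\<Omega> i)) *\<^sub>R y) + l *\<^sub>R y"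
    by (simp add: W_def scaleR_left_distrib scaleR_sum_left)
  ultimately show ?thesis
    by (simp add: scaleR_diff_right sum_subtractf)
qed

lemma W_gradient_inner:
  "W y * ((y - F y) \<bullet> h)
    = (\<Sum>i\<in>{1..p}. \<alpha> i * (((y - closest_point (\<Omega> i) y) \<bullet> h) / infdist y (\<Omega> i))) + l * (y \<bullet> h) - v \<bullet> h"
proof -
  have "W y * ((y - F y) \<bullet> h) = (W y *\<^sub>R (y - F y)) \<bullet> h" by simp
  also have "\<dots> = (\<Sum>i\<in>{1..p}. \<alpha> i * (((y - closest_point (\<Omega> i) y) \<bullet> h) / infdist y (\<Omega> i)))
      + l * (y \<bullet> h) - v \<bullet> h"
    unfolding W_gradient by (simp add: inner_diff_left inner_add_left inner_sum_left)
  finally show ?thesis .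
qed

text \<open>Every summand \<open>\<alpha>\<^sub>i d(\<cdot>;\<Omega>\<^sub>i)\<close> contributes a gradient of norm \<open>\<alpha>\<^sub>i\<close>, however close the point is to \<open>\<Omega>\<^sub>i\<close>.\<close>

lemma norm_gradient_le:
  assumes "y \<in> S"
  shows "norm (W y *\<^sub>R (y - F y)) \<le> (\<Sum>i\<in>{1..p}. \<alpha> i) + l * norm y + norm v"
proof -
  have term_eq: "norm ((\<alpha> i / infdist y (\<Omega> i)) *\<^sub>R (y - closest_point (\<Omega> i) y)) = \<alpha> i"
    if i: "i \<in> {1..p}" for i
    using sets[OF i] \<alpha>[OF i] infdist_pos[OF i assms] infdist_eq_norm_closest_point[of "\<Omega> i" y] by simp
  have "norm (\<Sum>i\<in>{1..p}. (\<alpha> i / infdist y (\<Omega> i)) *\<^sub>R (y - closest_point (\<Omega> i) y)) \<le> (\<Sum>i\<in>{1..p}. \<alpha> i)"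
    by (rule sum_norm_le) (simp only: term_eq)
  moreover have "norm (a + l *\<^sub>R y - v) \<le> norm a + l * norm y + norm v" for a
    using norm_triangle_ineq4[of "a + l *\<^sub>R y" v] norm_triangle_ineq[of a "l *\<^sub>R y"] l by simp
  ultimately show ?thesis
    unfolding W_gradient by (smt (verit, best))
qed

lemma half_norm_square_expand:
  fixes x y :: "real ^ 'n"
  shows "l / 2 * (norm x)\<^sup>2 = l / 2 * (norm y)\<^sup>2 + l * (y \<bullet> (x - y)) + l / 2 * (norm (x - y))\<^sup>2"
  by (simp add: power2_norm_eq_inner inner_diff_left inner_diff_right inner_commute algebra_simps)

lemma objective_lower:
  assumes "y \<in> S"
  shows "\<phi> y + W y * ((y - F y) \<bullet> (x - y)) + l / 2 * (norm (x - y))\<^sup>2 \<le> \<phi> x"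
proof -
  let ?g = "\<lambda>i. ((y - closest_point (\<Omega> i) y) \<bullet> (x - y)) / infdist y (\<Omega> i)"
  have "(\<Sum>i\<in>{1..p}. \<alpha> i * (infdist y (\<Omega> i) + ?g i)) \<le> (\<Sum>i\<in>{1..p}. \<alpha> i * infdist x (\<Omega> i))"
    by (intro sum_mono mult_left_mono infdist_lower_linear)
      (use sets \<alpha> infdist_pos assms in \<open>auto simp: less_imp_le\<close>)
  hence "(\<Sum>i\<in>{1..p}. \<alpha> i * infdist y (\<Omega> i)) + (\<Sum>i\<in>{1..p}. \<alpha> i * ?g i)
      \<le> (\<Sum>i\<in>{1..p}. \<alpha> i * infdist x (\<Omega> i))"
    by (simp add: distrib_left sum.distrib)
  thus ?thesis
    unfolding weiszfeld_objective_def W_gradient_inner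
    using half_norm_square_expand[of x y] inner_diff_right[of v x y] by linarith
qed

lemma objective_upper:
  assumes "y \<in> S"
  shows "\<phi> x \<le> \<phi> y + W y * ((y - F y) \<bullet> (x - y)) + W y / 2 * (norm (x - y))\<^sup>2"
proof -
  let ?g = "\<lambda>i. ((y - closest_point (\<Omega> i) y) \<bullet> (x - y)) / infdist y (\<Omega> i)"
  let ?N = "(norm (x - y))\<^sup>2"
  have "(\<Sum>i\<in>{1..p}. \<alpha> i * infdist x (\<Omega> i))
      \<le> (\<Sum>i\<in>{1..p}. \<alpha> i * (infdist y (\<Omega> i) + ?g i + ?N / (2 * infdist y (\<Omega> i))))"
    by (intro sum_mono mult_left_mono infdist_upper_quadratic)
      (use sets \<alpha> infdist_pos assms in \<open>auto simp: less_imp_le\<close>)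
  also have "\<dots> = (\<Sum>i\<in>{1..p}. \<alpha> i * infdist y (\<Omega> i)) + (\<Sum>i\<in>{1..p}. \<alpha> i * ?g i)
      + (\<Sum>i\<in>{1..p}. \<alpha> i / infdist y (\<Omega> i)) * (?N / 2)"
    by (simp add: distrib_left sum.distrib sum_distrib_right)
  also have "(\<Sum>i\<in>{1..p}. \<alpha> i / infdist y (\<Omega> i)) * (?N / 2) = W y / 2 * ?N - l / 2 * ?N"
    by (simp add: W_def algebra_simps)
  finally show ?thesis
    unfolding weiszfeld_objective_def W_gradient_inner
    using half_norm_square_expand[of x y] inner_diff_right[of v x y] by linarith
qed

lemma T_variational: "x \<in> S \<Longrightarrow> (F y - T y) \<bullet> (x - T y) \<le> 0"
  unfolding T_def using S by (intro closest_point_dot)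

text \<open>
  The point \<open>T y\<close> minimizes over \<open>S\<close> the upper quadratic at \<open>y\<close>, which has the curvature \<open>W y\<close>; by convexity
  of \<open>S\<close> this gains at least \<open>W y / 2 * \<parallel>T y - y\<parallel>\<^sup>2\<close>. Replacing \<open>W y\<close> by its lower bound \<open>l\<close> makes the gain uniform
  in \<open>y\<close>.
\<close>

lemma descent:
  assumes "y \<in> S"
  shows "\<phi> (T y) + l / 2 * (norm (T y - y))\<^sup>2 \<le> \<phi> y"
proof -
  have "(y - F y) \<bullet> (T y - y) = (F y - T y) \<bullet> (y - T y) - (norm (T y - y))\<^sup>2"
    by (simp add: power2_norm_eq_inner inner_diff_left inner_diff_right inner_commute)
  hence "(y - F y) \<bullet> (T y - y) \<le> - (norm (T y - y))\<^sup>2"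
    using T_variational[OF assms, of y] by linarith
  hence "W y * ((y - F y) \<bullet> (T y - y)) \<le> W y * (- (norm (T y - y))\<^sup>2)"
    using W_pos[of y] by (intro mult_left_mono) auto
  moreover have "l / 2 * (norm (T y - y))\<^sup>2 \<le> W y / 2 * (norm (T y - y))\<^sup>2"
    using W_ge[of y] by (intro mult_right_mono) auto
  ultimately show ?thesis
    using objective_upper[OF assms, of "T y"] by linarith
qed

text \<open>
  A short step certifies that \<open>y\<close> is near every minimizer \<open>z\<close>. The lower quadratic at \<open>y\<close>, evaluated at \<open>z\<close>,
  bounds \<open>l / 2 * \<parallel>y - z\<parallel>\<^sup>2\<close> by \<open>W y\<close> times \<open>\<langle>y - F y, y - z\<rangle>\<close>. With \<open>T y\<close> in place of both explicit \<open>y\<close>, that is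
  for \<open>\<langle>T y - F y, T y - z\<rangle>\<close>, this product would be nonpositive by the variational inequality, and replacing \<open>y\<close>
  by \<open>T y\<close> changes it by at most a multiple of the step length.
\<close>

lemma error_bound:
  assumes y: "y \<in> S" and z: "z \<in> S" and min: "\<phi> z \<le> \<phi> y"
  shows "l / 2 * (norm (y - z))\<^sup>2
    \<le> (W y * norm (y - z) + norm (W y *\<^sub>R (y - F y))) * norm (T y - y)"
proof -
  have "l / 2 * (norm (y - z))\<^sup>2 \<le> W y * ((y - F y) \<bullet> (y - z))"
    using objective_lower[OF y, of z] min by (simp add: norm_minus_commute inner_diff_right algebra_simps)
  also have "(y - F y) \<bullet> (y - z)
      = (y - T y) \<bullet> (y - z) + (y - F y) \<bullet> (y - T y) - (norm (T y - y))\<^sup>2 + (F y - T y) \<bullet> (z - T y)"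
    by (simp add: power2_norm_eq_inner inner_diff_left inner_diff_right inner_commute)
  also have "W y * \<dots> \<le> W y * ((y - T y) \<bullet> (y - z) + (y - F y) \<bullet> (y - T y))"
    using T_variational[OF z, of y] W_pos[of y] zero_le_power2[of "norm (T y - y)"]
    by (intro mult_left_mono) linarith+
  also have "\<dots> \<le> W y * (norm (T y - y) * norm (y - z)) + norm (W y *\<^sub>R (y - F y)) * norm (T y - y)"
  proof -
    have "W y * ((y - T y) \<bullet> (y - z)) \<le> W y * (norm (T y - y) * norm (y - z))"
      using norm_cauchy_schwarz[of "y - T y" "y - z"] W_pos[of y]
      by (intro mult_left_mono) (auto simp: norm_minus_commute)
    moreover have "W y * ((y - F y) \<bullet> (y - T y)) \<le> norm (W y *\<^sub>R (y - F y)) * norm (T y - y)"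
      using norm_cauchy_schwarz[of "W y *\<^sub>R (y - F y)" "y - T y"] by (simp add: norm_minus_commute)
    ultimately show ?thesis by (simp add: distrib_left)
  qed
  finally show ?thesis by (simp add: algebra_simps)
qed

section \<open>Minimizers and convergence\<close>

text \<open>
  The lower quadratic at \<open>y\<close> outgrows its linear part outside a ball around \<open>y\<close>. This one bound serves both
  the existence of a minimizer and the boundedness of the iterates.
\<close>

lemma sublevel_bounded:
  assumes y: "y \<in> S" and le: "\<phi> x \<le> \<phi> y"
  shows "norm (x - y) \<le> 2 * norm (W y *\<^sub>R (y - F y)) / l"
proof (cases "x = y")
  case False
  have "- (norm (W y *\<^sub>R (y - F y)) * norm (x - y)) \<le> W y * ((y - F y) \<bullet> (x - y))"
    using Cauchy_Schwarz_ineq2[of "W y *\<^sub>R (y - F y)" "x - y"] by simp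
  hence "l / 2 * norm (x - y) * norm (x - y) \<le> norm (W y *\<^sub>R (y - F y)) * norm (x - y)"
    using objective_lower[OF y, of x] le by (simp add: power2_eq_square)
  hence "l / 2 * norm (x - y) \<le> norm (W y *\<^sub>R (y - F y))"
    using False by (metis mult_le_cancel_right_pos right_minus_eq zero_less_norm_iff)
  thus ?thesis using l by (simp add: field_simps)
qed (use l in simp)

lemma continuous_on_objective: "continuous_on A \<phi>"
  unfolding weiszfeld_objective_def[abs_def] by (intro continuous_intros)

lemma minimizer_exists: "\<exists>z\<in>S. \<forall>y\<in>S. \<phi> z \<le> \<phi> y"
proof -
  obtain a where a: "a \<in> S" using S by blast
  define B where "B = cball a (2 * norm (W a *\<^sub>R (a - F a)) / l)"
  have "compact (S \<inter> B)" "a \<in> S \<inter> B"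
    using S a l by (auto simp: B_def intro: closed_Int_compact)
  then obtain z where z: "z \<in> S \<inter> B" "\<forall>y\<in>S \<inter> B. \<phi> z \<le> \<phi> y"
    using continuous_attains_inf[of "S \<inter> B" \<phi>] continuous_on_objective by blast
  have "\<phi> z \<le> \<phi> y" if "y \<in> S" for y
  proof (cases "\<phi> y \<le> \<phi> a")
    case True
    hence "y \<in> B" using sublevel_bounded[OF a True] by (simp add: B_def dist_norm norm_minus_commute[of a y])
    thus ?thesis using z(2) that by blast
  next
    case False
    thus ?thesis using bspec[OF z(2) \<open>a \<in> S \<inter> B\<close>] by linarith
  qed
  thus ?thesis using z(1) by blast
qed

lemma W_bounded_on_compact:
  assumes "compact K" "K \<subseteq> S"
  obtains M where "\<And>y. y \<in> K \<Longrightarrow> W y \<le> M"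
proof -
  have "continuous_on K W"
    unfolding W_def[abs_def]
    by (intro continuous_intros) (use assms infdist_pos in \<open>fastforce\<close>)
  hence "bounded (W ` K)"
    using assms(1) compact_continuous_image compact_imp_bounded by blast
  then obtain M where "\<forall>r\<in>W ` K. norm r \<le> M" unfolding bounded_iff by blast
  hence "W y \<le> M" if "y \<in> K" for y using that by fastforce
  thus ?thesis by (rule that)
qed

text \<open>
  Descent makes the steps tend to zero, and along the iterates \<open>error_bound\<close> holds with a constant \<open>C\<close>, so the
  distance to \<open>z\<close> tends to zero as well.
\<close>

lemma iterates_converge:
  fixes x :: "nat \<Rightarrow> real ^ 'n"
  assumes x0: "x 0 \<in> S" and step: "\<And>k. x (Suc k) = T (x k)"
    and z: "z \<in> S" "\<And>y. y \<in> S \<Longrightarrow> \<phi> z \<le> \<phi> y"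
  shows "x \<longlonglongrightarrow> z"
proof -
  have xS: "x k \<in> S" for k by (cases k) (simp_all add: x0 step T_in_S)
  have desc: "l / 2 * (norm (x (Suc k) - x k))\<^sup>2 \<le> \<phi> (x k) - \<phi> (x (Suc k))" for k
    using descent[OF xS[of k]] by (simp add: step)
  have anti: "\<phi> (x (Suc k)) \<le> \<phi> (x k)" for k
    using desc[of k] l by (smt (verit) mult_nonneg_nonneg zero_le_power2 divide_nonneg_nonneg)
  have dec: "decseq (\<lambda>k. \<phi> (x k))" using anti by (simp add: decseq_SucI)

  obtain c where c: "(\<lambda>k. \<phi> (x k)) \<longlonglongrightarrow> c"
    using decseq_convergent[OF dec, of "\<phi> z"] z xS by blast
  have gap: "(\<lambda>k. \<phi> (x k) - \<phi> (x (Suc k))) \<longlonglongrightarrow> 0"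
    using tendsto_diff[OF c LIMSEQ_Suc[OF c]] by simp
  have "(\<lambda>k. l / 2 * (norm (x (Suc k) - x k))\<^sup>2) \<longlonglongrightarrow> 0"
    by (rule Lim_null_comparison[OF always_eventually gap]) (use desc l in simp)
  hence "(\<lambda>k. 2 / l * (l / 2 * (norm (x (Suc k) - x k))\<^sup>2)) \<longlonglongrightarrow> 2 / l * 0"
    by (rule tendsto_mult_left)
  hence "(\<lambda>k. (norm (x (Suc k) - x k))\<^sup>2) \<longlonglongrightarrow> 0" using l by simp
  hence steps: "(\<lambda>k. norm (x (Suc k) - x k)) \<longlonglongrightarrow> 0"
    by (simp add: power_tendsto_0_iff)

  define R where "R = 2 * norm (W (x 0) *\<^sub>R (x 0 - F (x 0))) / l"
  have ball: "x k \<in> S \<inter> cball (x 0) R" for k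
    using sublevel_bounded[OF x0, of "x k"] decseqD[OF dec, of 0 k] xS[of k]
    by (simp add: R_def dist_norm norm_minus_commute)
  have "compact (S \<inter> cball (x 0) R)" using S by (intro closed_Int_compact) auto
  then obtain M where M: "\<And>k. W (x k) \<le> M"
    using W_bounded_on_compact[of "S \<inter> cball (x 0) R"] ball by (metis inf_le1)
  define r where "r = norm (x 0) + R"
  have xr: "norm (x k) \<le> r" for k
    using ball[of k] norm_triangle_sub[of "x k" "x 0"] by (simp add: r_def dist_norm norm_minus_commute)

  define C where "C = M * (r + norm z) + ((\<Sum>i\<in>{1..p}. \<alpha> i) + l * r + norm v)"
  have bound: "l / 2 * (norm (x k - z))\<^sup>2 \<le> C * norm (x (Suc k) - x k)" for k
  proof -
    have "norm (x k - z) \<le> r + norm z"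
      using norm_triangle_ineq4[of "x k" z] xr[of k] by linarith
    hence "W (x k) * norm (x k - z) \<le> M * (r + norm z)"
      using M[of k] W_pos[of "x k"] by (intro mult_mono) auto
    moreover have "norm (W (x k) *\<^sub>R (x k - F (x k))) \<le> (\<Sum>i\<in>{1..p}. \<alpha> i) + l * r + norm v"
      using norm_gradient_le[OF xS[of k]] mult_left_mono[OF xr[of k], of l] l by linarith
    ultimately have "(W (x k) * norm (x k - z) + norm (W (x k) *\<^sub>R (x k - F (x k))))
        * norm (x (Suc k) - x k) \<le> C * norm (x (Suc k) - x k)"
      by (intro mult_right_mono) (auto simp: C_def)
    thus ?thesis using error_bound[OF xS[of k] z(1) z(2)[OF xS[of k]]] by (simp add: step)
  qed
  have "(\<lambda>k. 2 / l * (C * norm (x (Suc k) - x k))) \<longlonglongrightarrow> 2 / l * (C * 0)"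
    by (intro tendsto_intros steps)
  hence lim: "(\<lambda>k. 2 / l * (C * norm (x (Suc k) - x k))) \<longlonglongrightarrow> 0" by simp
  have "(norm (x k - z))\<^sup>2 \<le> 2 / l * (C * norm (x (Suc k) - x k))" for k
    using bound[of k] l by (simp add: field_simps)
  hence "(\<lambda>k. (norm (x k - z))\<^sup>2) \<longlonglongrightarrow> 0"
    by (intro Lim_null_comparison[OF always_eventually lim]) simp
  hence "(\<lambda>k. norm (x k - z)) \<longlonglongrightarrow> 0"
    by (simp add: power_tendsto_0_iff)
  thus ?thesis by (simp add: LIM_zero_iff tendsto_norm_zero_iff)
qed

end

theorem theorem5p2:
  fixes p :: nat
    and \<Omega> :: "nat \<Rightarrow> (real ^ 'n) set"
    and S :: "(real ^ 'n) set"
    and \<alpha> :: "nat \<Rightarrow> real"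
    and l :: real
    and v :: "real ^ 'n"
    and x :: "nat \<Rightarrow> real ^ 'n"
  assumes "1 \<le> p"
    and "\<And>i. i \<in> {1..p} \<Longrightarrow> \<Omega> i \<noteq> {} \<and> closed (\<Omega> i) \<and> convex (\<Omega> i)"
    and "S \<noteq> {}" and "closed S" and "convex S"
    and "\<And>i. i \<in> {1..p} \<Longrightarrow> \<Omega> i \<inter> S = {}"
    and "\<And>i. i \<in> {1..p} \<Longrightarrow> 0 < \<alpha> i"
    and "0 < l"
    and "x 0 \<in> S"
    and "\<And>k. x (Suc k) = closest_point S (weiszfeld_map p \<Omega> \<alpha> l v (x k))"
  shows "\<exists>z. is_arg_min (weiszfeld_objective p \<Omega> \<alpha> l v) (\<lambda>y. y \<in> S) z
    \<and> (\<forall>y. is_arg_min (weiszfeld_objective p \<Omega> \<alpha> l v) (\<lambda>y. y \<in> S) y \<longrightarrow> y = z)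
    \<and> x \<longlonglongrightarrow> z"
proof -
  interpret weiszfeld p \<Omega> S \<alpha> l v
    using assms(2-8) by unfold_locales
  have lim: "x \<longlonglongrightarrow> z" if "is_arg_min \<phi> (\<lambda>y. y \<in> S) z" for z
    using that assms(9,10) by (intro iterates_converge) (auto simp: is_arg_min_linorder T_def)
  moreover obtain z where "is_arg_min \<phi> (\<lambda>y. y \<in> S) z"
    using minimizer_exists by (auto simp: is_arg_min_linorder)
  ultimately show ?thesis
    using LIMSEQ_unique by blast
qed

end
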